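(* Let $E\subset\mathbb{R}^n$ be open, let $L$ be a continuous vector field on $E$, let $q:E\to\mathbb{R}$ be continuous, and let $\eta,\xi\in C^1(E)$ be solutions of $(L+q)\psi=0$ on $E$, where $\eta$ has no zeros in $E$. Then $\xi/\eta$ is a solution of $L\phi=0$ on $E$.
   Context: A continuous vector field $L=\sum_{k=1}^n a_k\,\partial/\partial x_k$ ($a_k\in C^0(E)$) acts on $C^1(E)$ by $L\psi=\sum_k a_k\,\partial\psi/\partial x_k$, and $(L+q)\psi=L\psi+q\psi$. Solutions are $C^1$ functions. *)

theory Defs
  imports "HOL-Analysis.Analysis"
begin

definition partial_deriv :: "'n::finite \<Rightarrow> (real ^ 'n \<Rightarrow> real) \<Rightarrow> real ^ 'n \<Rightarrow> real" where
  "partial_deriv k f x = deriv (\<lambda>t. f (x + t *\<^sub>R axis k 1)) 0"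

(* All partial derivatives of order at most 1 exist and are continuous.  The existence
   clause cannot be dropped: deriv is total, with an arbitrary value where there is no
   derivative.  The notion is meant for open E. *)
definition C1_on :: "(real ^ 'n::finite) set \<Rightarrow> (real ^ 'n \<Rightarrow> real) \<Rightarrow> bool" where
  "C1_on E f \<longleftrightarrow> continuous_on E f \<and>
     (\<forall>k. (\<forall>x\<in>E. (\<lambda>t. f (x + t *\<^sub>R axis k 1)) field_differentiable (at 0)) \<and>
          continuous_on E (partial_deriv k f))"

definition vector_field_op ::
  "('n::finite \<Rightarrow> real ^ 'n \<Rightarrow> real) \<Rightarrow> (real ^ 'n \<Rightarrow> real) \<Rightarrow> real ^ 'n \<Rightarrow> real" where
  "vector_field_op a \<psi> x = (\<Sum>k\<in>UNIV. a k x * partial_deriv k \<psi> x)"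

definition add_potential ::
  "((real ^ 'n::finite \<Rightarrow> real) \<Rightarrow> real ^ 'n \<Rightarrow> real) \<Rightarrow> (real ^ 'n \<Rightarrow> real) \<Rightarrow>
   (real ^ 'n \<Rightarrow> real) \<Rightarrow> real ^ 'n \<Rightarrow> real" where
  "add_potential L q \<psi> x = L \<psi> x + q x * \<psi> x"

definition is_solution_on ::
  "(real ^ 'n::finite) set \<Rightarrow> ((real ^ 'n \<Rightarrow> real) \<Rightarrow> real ^ 'n \<Rightarrow> real) \<Rightarrow>
   (real ^ 'n \<Rightarrow> real) \<Rightarrow> bool" where
  "is_solution_on E D \<psi> \<longleftrightarrow> C1_on E \<psi> \<and> (\<forall>x\<in>E. D \<psi> x = 0)"

end

theory Submission
  imports Defs
begin

text \<open>
  The zero-order term disappears in the quotient. By the quotient rule along each coordinate line,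
  \<open>L (\<xi> / \<eta>) = (\<eta> * L \<xi> - \<xi> * L \<eta>) / \<eta>\<^sup>2\<close>. The equations give \<open>L \<xi> = - q * \<xi>\<close> and
  \<open>L \<eta> = - q * \<eta>\<close> with the same \<open>q\<close>, so the two products in the numerator are equal.
  The same formula, applied to each partial derivative, shows that \<open>\<xi> / \<eta>\<close> is again \<open>C\<^sup>1\<close>.
\<close>

lemma has_partial_deriv:
  assumes "C1_on E f" "x \<in> E"
  shows "((\<lambda>t. f (x + t *\<^sub>R axis k 1)) has_field_derivative partial_deriv k f x) (at 0)"
  using assms unfolding C1_on_def partial_deriv_def by (metis DERIV_deriv_iff_field_differentiable)

lemma has_partial_deriv_divide:
  assumes "C1_on E f" "C1_on E g" "x \<in> E" "g x \<noteq> 0"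
  shows "((\<lambda>t. f (x + t *\<^sub>R axis k 1) / g (x + t *\<^sub>R axis k 1)) has_field_derivative
           (partial_deriv k f x * g x - f x * partial_deriv k g x) / (g x * g x)) (at 0)"
  using DERIV_divide[OF has_partial_deriv[OF assms(1,3)] has_partial_deriv[OF assms(2,3)], of k k]
    assms(4) by simp

lemma partial_deriv_divide:
  assumes "C1_on E f" "C1_on E g" "x \<in> E" "g x \<noteq> 0"
  shows "partial_deriv k (\<lambda>y. f y / g y) x =
           (partial_deriv k f x * g x - f x * partial_deriv k g x) / (g x * g x)"
  unfolding partial_deriv_def[of k "\<lambda>y. f y / g y"]
  using has_partial_deriv_divide[OF assms] by (rule DERIV_imp_deriv)

lemma C1_on_divide:
  assumes f: "C1_on E f" and g: "C1_on E g" and nz: "\<And>x. x \<in> E \<Longrightarrow> g x \<noteq> 0"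
  shows "C1_on E (\<lambda>x. f x / g x)"
proof -
  have cont: "continuous_on E f" "continuous_on E g"
    "continuous_on E (partial_deriv k f)" "continuous_on E (partial_deriv k g)" for k
    using f g by (auto simp: C1_on_def)
  have "continuous_on E (partial_deriv k (\<lambda>x. f x / g x))" for k
  proof -
    have "continuous_on E
        (\<lambda>x. (partial_deriv k f x * g x - f x * partial_deriv k g x) / (g x * g x))"
      using nz by (intro continuous_intros cont) auto
    then show ?thesis
      by (rule continuous_on_eq) (simp add: partial_deriv_divide[OF f g] nz)
  qed
  moreover have "continuous_on E (\<lambda>x. f x / g x)"
    using nz by (intro continuous_intros cont) auto
  moreover have "(\<lambda>t. f (x + t *\<^sub>R axis k 1) / g (x + t *\<^sub>R axis k 1)) field_differentiable (at 0)"
    if "x \<in> E" for x k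
    using has_partial_deriv_divide[OF f g that nz[OF that]] field_differentiable_def by blast
  ultimately show ?thesis
    by (simp add: C1_on_def)
qed

lemma vector_field_op_divide:
  assumes "C1_on E f" "C1_on E g" "x \<in> E" "g x \<noteq> 0"
  shows "vector_field_op a (\<lambda>y. f y / g y) x =
           (vector_field_op a f x * g x - f x * vector_field_op a g x) / (g x * g x)"
  unfolding vector_field_op_def partial_deriv_divide[OF assms]
  by (simp add: sum_distrib_left sum_distrib_right sum_subtractf[symmetric] sum_divide_distrib
      algebra_simps)

theorem mainTheorem9:
  fixes E :: "(real ^ 'n::finite) set"
    and a :: "'n \<Rightarrow> real ^ 'n \<Rightarrow> real"
    and q \<eta> \<xi> :: "real ^ 'n \<Rightarrow> real"
  assumes "open E"
    and "\<And>k. continuous_on E (a k)"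
    and "continuous_on E q"
    and "is_solution_on E (add_potential (vector_field_op a) q) \<eta>"
    and "is_solution_on E (add_potential (vector_field_op a) q) \<xi>"
    and "\<And>x. x \<in> E \<Longrightarrow> \<eta> x \<noteq> 0"
  shows "is_solution_on E (vector_field_op a) (\<lambda>x. \<xi> x / \<eta> x)"
proof -
  have C1: "C1_on E \<xi>" "C1_on E \<eta>"
    using assms(4,5) by (simp_all add: is_solution_on_def)
  have "vector_field_op a (\<lambda>x. \<xi> x / \<eta> x) x = 0" if x: "x \<in> E" for x
  proof -
    have "vector_field_op a \<xi> x = - q x * \<xi> x" "vector_field_op a \<eta> x = - q x * \<eta> x"
      using assms(4,5) x by (auto simp: is_solution_on_def add_potential_def eq_neg_iff_add_eq_0)
    then show ?thesis
      by (simp add: vector_field_op_divide[OF C1 x assms(6)[OF x]])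
  qed
  then show ?thesis
    using C1_on_divide[OF C1 assms(6)] by (simp add: is_solution_on_def)
qed

end
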